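(* Let $p$ be an odd prime and let $G$ be a quasi-powerful $p$-group. Then $G^{p^{i}}$ is a powerful $p$-group for all $i\ge 1$.
   Context: For an odd prime $p$, a finite $p$-group $G$ is powerful if $[G,G]\le G^{p}$, and $G$ is quasi-powerful if $G/Z(G)$ is powerful. $G^{p^{i}}=\langle g^{p^{i}}\mid g\in G\rangle$. *)

theory Defs
  imports "HOL-Algebra.Algebra"
begin

definition group_center :: "('a, 'b) monoid_scheme \<Rightarrow> 'a set" where
  "group_center G = {z \<in> carrier G. \<forall>g \<in> carrier G. z \<otimes>\<^bsub>G\<^esub> g = g \<otimes>\<^bsub>G\<^esub> z}"

definition power_subgroup :: "('a, 'b) monoid_scheme \<Rightarrow> nat \<Rightarrow> 'a set" where
  "power_subgroup G n = generate G {g [^]\<^bsub>G\<^esub> n | g. g \<in> carrier G}"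

definition p_group :: "nat \<Rightarrow> ('a, 'b) monoid_scheme \<Rightarrow> bool" where
  "p_group p G \<longleftrightarrow> group G \<and> finite (carrier G) \<and> (\<exists>n. order G = p ^ n)"

definition powerful :: "nat \<Rightarrow> ('a, 'b) monoid_scheme \<Rightarrow> bool" where
  "powerful p G \<longleftrightarrow> p_group p G \<and> derived G (carrier G) \<subseteq> power_subgroup G p"

definition quasi_powerful :: "nat \<Rightarrow> ('a, 'b) monoid_scheme \<Rightarrow> bool" where
  "quasi_powerful p G \<longleftrightarrow> p_group p G \<and> powerful p (G Mod (group_center G))"

end

theory Submission
  imports Defs
begin

text \<open>
  Put \<open>M = G ^ q\<close> with \<open>q = p ^ (i + 1)\<close>. Since \<open>M\<close> is contained in the subgroup generated by
  the \<open>p\<close>-th powers of \<open>p ^ i\<close>-th powers, it suffices that \<open>p ^ i\<close>-th powers commute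
  modulo \<open>M\<close>. In a powerful group \<open>[G, x ^ (p ^ i)]\<close> lies in \<open>G ^ q\<close>; applied to
  \<open>G/Z(G)\<close>, this makes \<open>[y, x ^ (p ^ i)]\<close> central modulo \<open>M\<close>. As the \<open>p\<close>-th
  power of \<open>x ^ (p ^ i)\<close> is trivial modulo \<open>M\<close>, so is the \<open>p\<close>-th power of this central commutator,
  and \<open>x ^ (p ^ i)\<close> commutes with \<open>y ^ p\<close>.

  The fact on powerful groups goes by induction on \<open>i\<close>. If the step fails, choose a normal
  subgroup \<open>L\<close> maximal among those containing the required power subgroup for which
  it still fails modulo \<open>L\<close>. As \<open>G/L\<close> has nontrivial centre,
  maximality makes the commutators in question central modulo \<open>L\<close>, and class-two
  power identities for odd \<open>p\<close> show that they vanish.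
\<close>

text \<open>The factors are ordered as in \<open>derived_set\<close>, so that membership in the
  derived subgroup unfolds directly to this term.\<close>

definition commutator :: "('a, 'b) monoid_scheme \<Rightarrow> 'a \<Rightarrow> 'a \<Rightarrow> 'a" where
  "commutator G a b = a \<otimes>\<^bsub>G\<^esub> b \<otimes>\<^bsub>G\<^esub> inv\<^bsub>G\<^esub> a \<otimes>\<^bsub>G\<^esub> inv\<^bsub>G\<^esub> b"

text \<open>For normal \<open>L\<close> this is the preimage in \<open>G\<close> of the centre of
  \<open>G Mod L\<close> (see \<open>mem_center_mod_iff\<close>); iterating it climbs the upper
  central series of the quotient.\<close>

definition center_mod :: "('a, 'b) monoid_scheme \<Rightarrow> 'a set \<Rightarrow> 'a set" where
  "center_mod G L = {g \<in> carrier G. \<forall>y \<in> carrier G. commutator G g y \<in> L}"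

section \<open>Commutators and the centre\<close>

context group
begin

lemma inv_cancel_left [simp]:
  assumes "x \<in> carrier G" "y \<in> carrier G"
  shows "inv x \<otimes> (x \<otimes> y) = y" "x \<otimes> (inv x \<otimes> y) = y"
  using assms by (simp_all flip: m_assoc)

lemma commutes_mult:
  assumes "x \<in> carrier G" "u \<in> carrier G" "v \<in> carrier G" "x \<otimes> u = u \<otimes> x" "x \<otimes> v = v \<otimes> x"
  shows "x \<otimes> (u \<otimes> v) = (u \<otimes> v) \<otimes> x"
proof -
  have "x \<otimes> (u \<otimes> v) = (x \<otimes> u) \<otimes> v" using assms(1-3) by (simp add: m_assoc)
  also have "\<dots> = u \<otimes> (x \<otimes> v)" using assms(1-3) by (simp add: m_assoc assms(4))
  also have "\<dots> = (u \<otimes> v) \<otimes> x" using assms(1-3) by (simp add: m_assoc assms(5))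
  finally show ?thesis .
qed

lemma commutes_inv:
  assumes "x \<in> carrier G" "u \<in> carrier G" "x \<otimes> u = u \<otimes> x"
  shows "x \<otimes> inv u = inv u \<otimes> x"
proof -
  have "inv u \<otimes> (u \<otimes> x) \<otimes> inv u = inv u \<otimes> (x \<otimes> u) \<otimes> inv u" using assms by simp
  then show ?thesis using assms(1,2) by (simp add: m_assoc)
qed

lemma conj_pow:
  assumes "x \<in> carrier G" "y \<in> carrier G"
  shows "(y \<otimes> x \<otimes> inv y) [^] (n::nat) = y \<otimes> x [^] n \<otimes> inv y"
proof (induction n)
  case (Suc n)
  then show ?case using assms by (simp add: m_assoc)
qed (use assms in simp)

lemma commutator_closed [simp]:
  "a \<in> carrier G \<Longrightarrow> b \<in> carrier G \<Longrightarrow> commutator G a b \<in> carrier G"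
  by (simp add: commutator_def)

lemma mult_eq_commutator_mult:
  assumes "a \<in> carrier G" "b \<in> carrier G"
  shows "a \<otimes> b = commutator G a b \<otimes> (b \<otimes> a)"
  using assms by (simp add: commutator_def m_assoc)

lemma inv_commutator:
  assumes "a \<in> carrier G" "b \<in> carrier G"
  shows "inv (commutator G a b) = commutator G b a"
  using assms by (simp add: commutator_def m_assoc inv_mult_group)

lemma commutator_eq_one_iff:
  assumes "a \<in> carrier G" "b \<in> carrier G"
  shows "commutator G a b = \<one> \<longleftrightarrow> a \<otimes> b = b \<otimes> a"
  using mult_eq_commutator_mult[OF assms] assms
  by (metis commutator_closed l_one m_closed one_closed r_cancel)

lemma centerD:
  "z \<in> group_center G \<Longrightarrow> z \<in> carrier G"
  "z \<in> group_center G \<Longrightarrow> g \<in> carrier G \<Longrightarrow> z \<otimes> g = g \<otimes> z"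
  by (auto simp: group_center_def)

lemma centerI:
  assumes "z \<in> carrier G" "\<And>g. g \<in> carrier G \<Longrightarrow> g \<otimes> z = z \<otimes> g"
  shows "z \<in> group_center G"
  using assms(1) assms(2)[symmetric] by (simp add: group_center_def)

lemma subgroup_center: "subgroup (group_center G) G"
proof
  show "group_center G \<subseteq> carrier G"
    by (auto simp: group_center_def)
  show "\<one> \<in> group_center G"
    by (rule centerI) simp_all
next
  fix x y assume xy: "x \<in> group_center G" "y \<in> group_center G"
  show "x \<otimes> y \<in> group_center G"
  proof (rule centerI)
    show "x \<otimes> y \<in> carrier G" using xy centerD(1) by simp
    show "g \<otimes> (x \<otimes> y) = x \<otimes> y \<otimes> g" if "g \<in> carrier G" for g
      by (rule commutes_mult) (use that xy centerD(1) centerD(2)[symmetric] in simp_all)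
  qed
next
  fix x assume x: "x \<in> group_center G"
  show "inv x \<in> group_center G"
  proof (rule centerI)
    show "inv x \<in> carrier G" using x centerD(1) by simp
    show "g \<otimes> inv x = inv x \<otimes> g" if "g \<in> carrier G" for g
      by (rule commutes_inv) (use that x centerD(1) centerD(2)[symmetric] in simp_all)
  qed
qed

lemma normal_center: "group_center G \<lhd> G"
proof (rule normal_invI[OF subgroup_center])
  fix x h assume "x \<in> carrier G" "h \<in> group_center G"
  then have "x \<otimes> h \<otimes> inv x = h"
    using centerD[of h] by (simp add: m_assoc)
  with \<open>h \<in> group_center G\<close> show "x \<otimes> h \<otimes> inv x \<in> group_center G" by simp
qed

section \<open>Power identities for central commutators\<close>

text \<open>Moving \<open>b\<close> to the left past each of the \<open>n\<close> factors
  \<open>a\<close> releases one central factor \<open>z\<close>.\<close>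

lemma pow_mult_swap_central:
  assumes "a \<in> carrier G" "b \<in> carrier G" "z \<in> group_center G" "a \<otimes> b = z \<otimes> (b \<otimes> a)"
  shows "a [^] (n::nat) \<otimes> b = z [^] n \<otimes> (b \<otimes> a [^] n)"
proof (induction n)
  case 0
  then show ?case using assms by simp
next
  case (Suc n)
  note z = centerD(1)[OF assms(3)]
  have "a [^] Suc n \<otimes> b = a [^] n \<otimes> (z \<otimes> (b \<otimes> a))"
    using assms by (simp add: m_assoc)
  also have "\<dots> = (a [^] n \<otimes> z) \<otimes> (b \<otimes> a)"
    using assms z by (simp add: m_assoc)
  also have "a [^] n \<otimes> z = z \<otimes> a [^] n"
    using centerD(2)[OF assms(3), of "a [^] n"] assms by simp
  also have "z \<otimes> a [^] n \<otimes> (b \<otimes> a) = z \<otimes> (a [^] n \<otimes> b) \<otimes> a"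
    using assms z by (simp add: m_assoc)
  also have "\<dots> = (z \<otimes> z [^] n) \<otimes> (b \<otimes> a [^] n) \<otimes> a"
    using assms z Suc by (simp add: m_assoc)
  also have "\<dots> = z [^] Suc n \<otimes> (b \<otimes> a [^] Suc n)"
    using assms z by (simp add: m_assoc nat_pow_Suc2[symmetric] del: nat_pow_Suc)
  finally show ?case .
qed

text \<open>In the induction step the new \<open>b\<close> has to pass \<open>a [^] n\<close>, which
  releases \<open>z [^] n\<close>; the exponents add up to the triangular number n(n-1)/2.\<close>

lemma mult_pow_central_commutator:
  assumes "a \<in> carrier G" "b \<in> carrier G" "z \<in> group_center G" "a \<otimes> b = z \<otimes> (b \<otimes> a)"
  shows "(b \<otimes> a) [^] (n::nat) = z [^] (\<Sum>k<n. k) \<otimes> (b [^] n \<otimes> a [^] n)"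
proof (induction n)
  case 0
  then show ?case using assms by simp
next
  case (Suc n)
  note z = centerD(1)[OF assms(3)]
  \<comment> \<open>The swap lemma is reused with \<open>z\<close> in place of \<open>a\<close> and
    trivial commutator \<open>\<one>\<close>: what commutes with \<open>z\<close> commutes with its
    powers.\<close>
  have zn: "b [^] n \<otimes> z [^] n = z [^] n \<otimes> b [^] n"
    using assms z pow_mult_swap_central[of z "b [^] n" \<one> n] centerD(2)[OF assms(3), of "b [^] n"]
      subgroup.one_closed[OF subgroup_center] by simp
  let ?t = "z [^] (\<Sum>k<n. k)"
  have "(b \<otimes> a) [^] Suc n = ?t \<otimes> (b [^] n \<otimes> (a [^] n \<otimes> b) \<otimes> a)"
    using assms z Suc by (simp add: m_assoc)
  also have "a [^] n \<otimes> b = z [^] n \<otimes> (b \<otimes> a [^] n)"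
    using pow_mult_swap_central[OF assms] .
  also have "b [^] n \<otimes> (z [^] n \<otimes> (b \<otimes> a [^] n)) = (b [^] n \<otimes> z [^] n) \<otimes> (b \<otimes> a [^] n)"
    using assms z by (simp add: m_assoc)
  also have "?t \<otimes> ((b [^] n \<otimes> z [^] n) \<otimes> (b \<otimes> a [^] n) \<otimes> a)
      = (?t \<otimes> z [^] n) \<otimes> (b [^] Suc n \<otimes> a [^] Suc n)"
    unfolding zn using assms z by (simp add: m_assoc)
  also have "?t \<otimes> z [^] n = z [^] (\<Sum>k<Suc n. k)"
    using z by (simp add: nat_pow_mult add.commute)
  finally show ?case .
qed

text \<open>Swapping \<open>a [^] n = \<one>\<close> with \<open>b\<close> changes nothing, yet
  releases the \<open>n\<close>-th power of the commutator.\<close>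

lemma central_commutator_pow_eq_one:
  assumes "a \<in> carrier G" "b \<in> carrier G" "commutator G a b \<in> group_center G" "a [^] (n::nat) = \<one>"
  shows "commutator G a b [^] n = \<one>"
  using pow_mult_swap_central[OF assms(1-3) mult_eq_commutator_mult[OF assms(1,2)], of n] assms
  by (metis commutator_closed l_one nat_pow_closed one_closed r_cancel r_one)

lemma central_commutator_inv:
  assumes "a \<in> carrier G" "b \<in> carrier G" "commutator G a b \<in> group_center G"
  shows "commutator G b a \<in> group_center G"
  using inv_commutator[OF assms(1,2)] subgroup.m_inv_closed[OF subgroup_center assms(3)] by simp

lemma central_commutator_pow_eq_one':
  assumes "a \<in> carrier G" "b \<in> carrier G" "commutator G a b \<in> group_center G" "a [^] (n::nat) = \<one>"
  shows "commutator G b a [^] n = \<one>"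
  using central_commutator_pow_eq_one[OF assms] inv_commutator[OF assms(1,2)] assms
  by (metis commutator_closed inv_one nat_pow_inv)

text \<open>The commutator has order dividing \<open>n\<close>, and for odd \<open>n\<close> the
  exponent n(n-1)/2 of the collected factor is a multiple of \<open>n\<close>, so this factor
  vanishes.\<close>

lemma mult_pow_odd:
  assumes "a \<in> carrier G" "b \<in> carrier G" "commutator G a b \<in> group_center G" "a [^] n = \<one>" "odd (n::nat)"
  shows "(a \<otimes> b) [^] n = b [^] n"
proof -
  let ?z = "commutator G b a"
  have z: "?z \<in> group_center G" "?z [^] n = \<one>"
    using central_commutator_inv central_commutator_pow_eq_one' assms by auto
  have "n dvd (\<Sum>k<n. k)"
  proof -
    obtain m where m: "n = 2 * m + 1" using assms(5) by (elim oddE)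
    have "(\<Sum>k<2 * m + 1. k) = (2 * m + 1) * m" by (induction m) auto
    then have "(\<Sum>k<n. k) = n * m" by (simp only: m)
    then show ?thesis by simp
  qed
  then have "?z [^] (\<Sum>k<n. k) = \<one>"
    using z(2) assms by (metis commutator_closed dvdE nat_pow_one nat_pow_pow)
  then show ?thesis
    using mult_pow_central_commutator[OF assms(2,1) z(1) mult_eq_commutator_mult[OF assms(2,1)], of n] assms
    by simp
qed

text \<open>Swapping \<open>b [^] n\<close> with \<open>a\<close> releases the \<open>n\<close>-th
  power of \<open>[b,a]\<close>, which is trivial because \<open>a [^] n\<close> is.\<close>

lemma commutes_pow_of_pow_eq_one:
  assumes "a \<in> carrier G" "b \<in> carrier G" "commutator G a b \<in> group_center G" "a [^] (n::nat) = \<one>"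
  shows "b [^] n \<otimes> a = a \<otimes> b [^] n"
proof -
  have "commutator G b a [^] n = \<one>"
    using central_commutator_pow_eq_one' assms by auto
  then show ?thesis
    using pow_mult_swap_central[OF assms(2,1) central_commutator_inv[OF assms(1-3)]
        mult_eq_commutator_mult[OF assms(2,1)], of n] assms by simp
qed

text \<open>The generated subgroup has class at most two, so by \<open>mult_pow_odd\<close> a
  product of two elements of order dividing \<open>n\<close> again has order dividing
  \<open>n\<close>.\<close>

lemma generate_pow_eq_one:
  assumes U: "U \<subseteq> carrier G" and n: "odd (n::nat)" and exp: "\<And>u. u \<in> U \<Longrightarrow> u [^] n = \<one>"
    and cen: "\<And>u v. u \<in> generate G U \<Longrightarrow> v \<in> generate G U \<Longrightarrow> commutator G u v \<in> group_center G"
    and "u \<in> generate G U"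
  shows "u [^] n = \<one>"
  using \<open>u \<in> generate G U\<close>
proof (induction rule: generate.induct)
  case (inv h)
  then show ?case using exp U by (metis inv_one nat_pow_inv subsetD)
next
  case (eng h1 h2)
  then show ?case using mult_pow_odd[OF _ _ cen, of h1 h2 n] n generate_in_carrier[OF U] by simp
qed (use exp in auto)

text \<open>Conjugation by \<open>y\<close> replaces \<open>x\<close> by \<open>[y,x] x\<close>, and the two factors
  generate a group of class two in which the first has order dividing \<open>n\<close>.\<close>

lemma pow_commutes_of_commutator_in_generate:
  assumes U: "U \<subseteq> carrier G" and n: "odd (n::nat)" and exp: "\<And>u. u \<in> U \<Longrightarrow> u [^] n = \<one>"
    and cen: "\<And>u v. u \<in> generate G U \<Longrightarrow> v \<in> carrier G \<Longrightarrow> commutator G u v \<in> group_center G"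
    and x: "x \<in> carrier G" and y: "y \<in> carrier G" and xy: "commutator G y x \<in> generate G U"
  shows "y \<otimes> x [^] n = x [^] n \<otimes> y"
proof -
  let ?k = "commutator G y x"
  have "?k [^] n = \<one>"
    using generate_pow_eq_one[OF U n exp _ xy] cen generate_in_carrier[OF U] by blast
  then have "(?k \<otimes> x) [^] n = x [^] n"
    using mult_pow_odd[OF _ x cen[OF xy x]] x y n by simp
  moreover have "?k \<otimes> x = y \<otimes> x \<otimes> inv y"
    using x y by (simp add: commutator_def m_assoc)
  moreover have "(y \<otimes> x \<otimes> inv y) [^] n = y \<otimes> x [^] n \<otimes> inv y"
    using x y by (rule conj_pow)
  ultimately show ?thesis
    using x y by (metis inv_solve_right m_closed nat_pow_closed)
qed

lemma commutes_generate:
  assumes U: "U \<subseteq> carrier G" and x: "x \<in> carrier G" and "\<And>u. u \<in> U \<Longrightarrow> x \<otimes> u = u \<otimes> x"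
    and "u \<in> generate G U"
  shows "x \<otimes> u = u \<otimes> x"
  using assms(4)
proof (induction rule: generate.induct)
  case (inv h)
  then show ?case
    using U by (intro commutes_inv[OF x] assms(3)) auto
next
  case (eng h1 h2)
  then show ?case by (intro commutes_mult[OF x] generate_in_carrier[OF U])
qed (use assms in auto)

section \<open>Power subgroups\<close>

lemma power_set_incl: "{g [^] n | g. g \<in> carrier G} \<subseteq> carrier G" for n :: nat
  by auto

lemma power_subgroup_normal: "power_subgroup G n \<lhd> G"
  unfolding power_subgroup_def
proof (rule normal_generateI[OF power_set_incl])
  fix h g assume "h \<in> {g [^] n | g. g \<in> carrier G}" and g: "g \<in> carrier G"
  then obtain a where a: "a \<in> carrier G" "h = a [^] n" by auto
  then have "(g \<otimes> a \<otimes> inv g) [^] n = g \<otimes> h \<otimes> inv g"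
    using conj_pow g by simp
  then show "g \<otimes> h \<otimes> inv g \<in> {g [^] n | g. g \<in> carrier G}"
    using a g by (metis (mono_tags, lifting) inv_closed m_closed mem_Collect_eq)
qed

lemma pow_in_power_subgroup: "g \<in> carrier G \<Longrightarrow> g [^] n \<in> power_subgroup G n"
  unfolding power_subgroup_def by (rule generate.incl) auto

end

section \<open>Commutators, centres and powers in quotients\<close>

lemma (in group_hom) hom_commutator:
  assumes "a \<in> carrier G" "b \<in> carrier G"
  shows "h (commutator G a b) = commutator H (h a) (h b)"
  using assms by (simp add: commutator_def)

context normal
begin

lemma group_hom_Mod: "group_hom G (G Mod H) ((#>) H)"
  using r_coset_hom_Mod factorgroup_is_group is_group
  by (simp add: group_hom_def group_hom_axioms_def)

lemma rcos_eq_self_iff: "x \<in> carrier G \<Longrightarrow> H #> x = H \<longleftrightarrow> x \<in> H"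
  using coset_join1 coset_join2 subgroup_axioms subset by blast

text \<open>The bridge between statements modulo \<open>H\<close> and honest commutation in
  \<open>G Mod H\<close>, where the power identities apply.\<close>

lemma commutator_mem_iff:
  assumes "a \<in> carrier G" "b \<in> carrier G"
  shows "commutator G a b \<in> H \<longleftrightarrow>
    (H #> a) \<otimes>\<^bsub>G Mod H\<^esub> (H #> b) = (H #> b) \<otimes>\<^bsub>G Mod H\<^esub> (H #> a)"
proof -
  interpret Q: group_hom G "G Mod H" "(#>) H" by (rule group_hom_Mod)
  show ?thesis
    using rcos_eq_self_iff[of "commutator G a b"] Q.hom_commutator[OF assms]
      Q.H.commutator_eq_one_iff[of "H #> a" "H #> b"] assms Q.hom_closed by simp
qed

lemma mem_center_mod_iff:
  "g \<in> carrier G \<Longrightarrow> g \<in> center_mod G H \<longleftrightarrow> H #> g \<in> group_center (G Mod H)"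
  by (auto simp: center_mod_def group_center_def commutator_mem_iff carrier_FactGroup
      simp del: mult_FactGroup)

lemma center_mod_normal: "center_mod G H \<lhd> G"
proof -
  interpret Q: group_hom G "G Mod H" "(#>) H" by (rule group_hom_Mod)
  interpret Z: normal "group_center (G Mod H)" "G Mod H" by (rule Q.H.normal_center)
  have eq: "center_mod G H = {g \<in> carrier G. H #> g \<in> group_center (G Mod H)}"
    using mem_center_mod_iff by (auto simp: center_mod_def)
  have "subgroup (center_mod G H) G"
    unfolding eq
    by (rule subgroupI)
       (auto simp del: mult_FactGroup one_FactGroup simp: Q.hom_mult Q.hom_inv intro: exI[of _ \<one>])
  then show ?thesis
    unfolding eq
    by (rule normal_invI) (auto simp del: mult_FactGroup one_FactGroup
        simp: Q.hom_mult Q.hom_inv intro!: Z.inv_op_closed2)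
qed

lemma subset_center_mod: "H \<subseteq> center_mod G H"
proof
  fix h assume h: "h \<in> H"
  interpret Q: group_hom G "G Mod H" "(#>) H" by (rule group_hom_Mod)
  have "H #> h = \<one>\<^bsub>G Mod H\<^esub>" using h rcos_eq_self_iff by auto
  then show "h \<in> center_mod G H"
    using h mem_center_mod_iff subgroup.one_closed[OF Q.H.subgroup_center] by auto
qed

lemma power_subgroup_Mod: "power_subgroup (G Mod H) n = (#>) H ` power_subgroup G n"
proof -
  interpret Q: group_hom G "G Mod H" "(#>) H" by (rule group_hom_Mod)
  have "{g [^]\<^bsub>G Mod H\<^esub> n | g. g \<in> carrier (G Mod H)} = (#>) H ` {g [^] n | g. g \<in> carrier G}"
    by (auto simp: carrier_FactGroup FactGroup_pow) (metis FactGroup_pow imageI)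
  then show ?thesis
    unfolding power_subgroup_def by (simp add: Q.generate_img[OF power_set_incl])
qed

lemma p_group_Mod:
  assumes "p_group p G" "Factorial_Ring.prime p"
  shows "p_group p (G Mod H)"
proof -
  have fin: "finite (carrier G)" using assms by (simp add: p_group_def)
  obtain n where n: "order G = p ^ n" using assms by (auto simp: p_group_def)
  have "order (G Mod H) dvd order G"
    using lagrange[OF subgroup_axioms] by (metis dvd_triv_left order_def partial_object.simps(1) FactGroup_def)
  then obtain k where "order (G Mod H) = p ^ k"
    using n assms(2) divides_primepow_nat by metis
  then show ?thesis
    using fin factorgroup_is_group by (auto simp: p_group_def carrier_FactGroup)
qed

end

section \<open>Centres of finite p-groups\<close>

text \<open>Class equation: were the centre trivial, every conjugacy class except that of
  \<open>\<one>\<close> would have size divisible by \<open>p\<close>, so the order would be 1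
  modulo \<open>p\<close>.\<close>

lemma (in group) p_group_center_nontrivial:
  assumes "p_group p G" "Factorial_Ring.prime p" "order G \<noteq> 1"
  shows "\<exists>z \<in> group_center G. z \<noteq> \<one>"
proof (rule ccontr)
  assume "\<not> ?thesis"
  then have triv: "z = \<one>" if "z \<in> group_center G" for z using that by auto
  have fin: "finite (carrier G)" using assms by (simp add: p_group_def)
  obtain n where n: "order G = p ^ n" using assms by (auto simp: p_group_def)
  define \<phi> where "\<phi> = (\<lambda>g. \<lambda>h \<in> carrier G. g \<otimes> h \<otimes> inv g)"
  interpret A: group_action G "carrier G" \<phi>
    unfolding \<phi>_def by (rule action_by_conjugation)
  let ?O = "orbits G (carrier G) \<phi>"
  have finO: "finite ?O" using fin by (simp add: orbits_def setcompr_eq_image)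
  have orb1: "orbit G \<phi> \<one> = {\<one>}"
    by (auto simp: orbit_def \<phi>_def intro!: exI[of _ \<one>])
  have in1: "{\<one>} \<in> ?O" unfolding orbits_def using orb1 by force
  have dvd: "p dvd card orb" if "orb \<in> ?O - {{\<one>}}" for orb
  proof -
    have "orb \<in> ?O" "orb \<noteq> {\<one>}" using that by simp_all
    then obtain x where x: "x \<in> carrier G" "orb = orbit G \<phi> x"
      unfolding orbits_def by blast
    have "x \<noteq> \<one>" using \<open>orb \<noteq> {\<one>}\<close> x(2) orb1 by metis
    \<comment> \<open>By orbit-stabilizer a class size is a power of \<open>p\<close>; size one
      would put \<open>x\<close> into the centre.\<close>
    have "card orb dvd p ^ n"
      using A.orbit_stabilizer_theorem[OF x(1)] x n by (metis dvd_triv_left)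
    moreover have "card orb \<noteq> 1"
    proof
      assume "card orb = 1"
      then have "orb = {x}" using A.orbit_refl[OF x(1)] x(2)
        by (metis card_1_singletonE singletonD)
      have "x \<in> group_center G"
      proof (rule centerI)
        fix g assume g: "g \<in> carrier G"
        then have "\<phi> g x \<in> orb" unfolding x(2) orbit_def by blast
        then have "g \<otimes> x \<otimes> inv g = x" using \<open>orb = {x}\<close> x(1) by (simp add: \<phi>_def)
        then have "g \<otimes> x \<otimes> inv g \<otimes> g = x \<otimes> g" by simp
        then show "g \<otimes> x = x \<otimes> g" using g x(1) by (simp add: m_assoc)
      qed (rule x(1))
      then show False using triv \<open>x \<noteq> \<one>\<close> by blast
    qed
    ultimately show ?thesis
      using assms(2) by (metis divides_primepow_nat dvd_power not_gr_zero power_0)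
  qed
  \<comment> \<open>Summing the constant 1 over the partition into orbits counts the
    elements.\<close>
  have "card (carrier G) = (\<Sum>orb\<in>?O. card orb)"
    using A.disjoint_sum[OF fin, of "\<lambda>_. 1::nat"] by simp
  also have "\<dots> = 1 + (\<Sum>orb\<in>?O - {{\<one>}}. card orb)"
    using sum.remove[OF finO in1, of card] by simp
  finally have "order G = 1 + (\<Sum>orb\<in>?O - {{\<one>}}. card orb)" by (simp add: order_def)
  moreover have "p dvd (\<Sum>orb\<in>?O - {{\<one>}}. card orb)" using dvd by (rule dvd_sum)
  moreover have "p dvd order G" using n assms(3) by (cases n) auto
  ultimately have "p dvd 1" by (metis dvd_add_left_iff)
  then show False using assms(2) by auto
qed

section \<open>Powerful and quasi-powerful groups\<close>

lemma (in group) powerful_commutator_pow: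
  assumes p: "Factorial_Ring.prime p" "odd p" "p_group p G" and pow: "derived G (carrier G) \<subseteq> power_subgroup G p"
    and "x \<in> carrier G" "y \<in> carrier G"
  shows "commutator G y (x [^] (p ^ i)) \<in> power_subgroup G (p ^ Suc i)"
  using assms(5,6)
proof (induction i arbitrary: x y)
  case 0
  then have "commutator G y x \<in> derived G (carrier G)"
    unfolding derived_def commutator_def by (intro generate.incl) auto
  with 0 show ?case using pow by auto
next
  case (Suc i)
  show ?case
  proof (rule ccontr)
    let ?M = "power_subgroup G (p ^ Suc (Suc i))"
    let ?U = "{g [^] (p ^ Suc i) | g. g \<in> carrier G}"
    let ?P = "power_subgroup G (p ^ Suc i)"
    \<comment> \<open>All pairs \<open>x\<close>, \<open>y\<close> are quantified inside
      \<open>bad\<close>, so that a subgroup that is not bad contains the commutators of every pair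
      at once.\<close>
    define bad where "bad = (\<lambda>L. L \<lhd> G \<and> ?M \<subseteq> L \<and>
      (\<exists>x\<in>carrier G. \<exists>y\<in>carrier G. commutator G y (x [^] (p ^ Suc i)) \<notin> L))"
    assume "commutator G y (x [^] (p ^ Suc i)) \<notin> ?M"
    then have "bad ?M" unfolding bad_def using power_subgroup_normal Suc.prems by blast
    then have ne: "Collect bad \<noteq> {}" by blast
    have fin: "finite (Collect bad)"
    proof (rule finite_subset)
      show "Collect bad \<subseteq> Pow (carrier G)"
        unfolding bad_def using normal_imp_subgroup subgroup.subset by blast
      show "finite (Pow (carrier G))" using p by (simp add: p_group_def)
    qed
    obtain L where "bad L" and max: "\<And>K. bad K \<Longrightarrow> L \<subseteq> K \<Longrightarrow> K = L"
      using finite_has_maximal[OF fin ne] by blast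
    then have L: "L \<lhd> G" "?M \<subseteq> L"
        "\<exists>x\<in>carrier G. \<exists>y\<in>carrier G. commutator G y (x [^] (p ^ Suc i)) \<notin> L"
      unfolding bad_def by blast+
    interpret L: normal L G by (rule L(1))
    interpret Q: group_hom G "G Mod L" "(#>) L" by (rule L.group_hom_Mod)
    \<comment> \<open>A bad \<open>L\<close> misses some commutator and hence is proper, so the
      quotient has a nontrivial centre.\<close>
    have "order (G Mod L) \<noteq> 1"
    proof
      assume "order (G Mod L) = 1"
      then have "carrier (G Mod L) = {L}"
        using Q.H.one_closed by (metis card_1_singletonE one_FactGroup order_def singletonD)
      then have "x \<in> L" if "x \<in> carrier G" for x
        using Q.hom_closed[OF that] L.rcos_eq_self_iff[OF that] by simp
      then show False using L(3) commutator_closed nat_pow_closed by blast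
    qed
    then obtain z where z: "z \<in> group_center (G Mod L)" "z \<noteq> L"
      using Q.H.p_group_center_nontrivial[OF L.p_group_Mod] p by auto
    then obtain g where g: "g \<in> carrier G" "z = L #> g"
      using Q.H.centerD(1) by (auto simp: carrier_FactGroup)
    \<comment> \<open>The preimage of this centre is strictly larger than \<open>L\<close>, so
      maximality forbids it to be bad.\<close>
    have "center_mod G L \<noteq> L"
      using z g L.mem_center_mod_iff[of g] L.rcos_eq_self_iff[of g] by auto
    then have "\<not> bad (center_mod G L)"
      using max L.subset_center_mod by blast
    then have comm: "commutator G y (x [^] (p ^ Suc i)) \<in> center_mod G L"
      if "x \<in> carrier G" "y \<in> carrier G" for x y
      unfolding bad_def using that L.center_mod_normal L.subset_center_mod L(2) by blast
    interpret C: normal "center_mod G L" G by (rule L.center_mod_normal)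
    \<comment> \<open>The iterated \<open>center_mod\<close> is the preimage of the second centre of
      \<open>G Mod L\<close>. As it is a subgroup, it contains all of \<open>?P\<close> once it
      contains the generators \<open>?U\<close>.\<close>
    have U: "?U \<subseteq> center_mod G (center_mod G L)"
    proof
      fix u assume "u \<in> ?U"
      then obtain g where g: "g \<in> carrier G" "u = g [^] (p ^ Suc i)" by auto
      have "commutator G u y \<in> center_mod G L" if "y \<in> carrier G" for y
        using C.m_inv_closed[OF comm[OF g(1) that]] inv_commutator[of y u] g that by simp
      then show "u \<in> center_mod G (center_mod G L)"
        using g by (simp add: center_mod_def[of G "center_mod G L"] del: power_Suc)
    qed
    have P: "?P \<subseteq> center_mod G (center_mod G L)"
      unfolding power_subgroup_def
      using generate_subgroup_incl[OF U] C.center_mod_normal normal_imp_subgroup by blast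
    let ?V = "(#>) L ` ?U"
    have V: "generate (G Mod L) ?V = (#>) L ` ?P"
      unfolding power_subgroup_def by (rule Q.generate_img[OF power_set_incl])
    have "commutator G y (x [^] (p ^ Suc i)) \<in> L" if xy: "x \<in> carrier G" "y \<in> carrier G" for x y
    proof -
      \<comment> \<open>The class-two lemma is applied to the image of \<open>x [^] (p ^ i)\<close>.
        Its commutator with \<open>y\<close> lies in the image of \<open>?P\<close> by induction,
        the generators have trivial \<open>p\<close>-th power since \<open>?M\<close> is contained
        in \<open>L\<close>, and centrality comes from the second centre.\<close>
      have "(L #> y) \<otimes>\<^bsub>G Mod L\<^esub> (L #> x [^] (p ^ i)) [^]\<^bsub>G Mod L\<^esub> p =
          (L #> x [^] (p ^ i)) [^]\<^bsub>G Mod L\<^esub> p \<otimes>\<^bsub>G Mod L\<^esub> (L #> y)"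
      proof (rule Q.H.pow_commutes_of_commutator_in_generate[where U = ?V])
        show "?V \<subseteq> carrier (G Mod L)" using power_set_incl Q.hom_closed by blast
        show "odd p" by fact
        show "L #> x [^] (p ^ i) \<in> carrier (G Mod L)" "L #> y \<in> carrier (G Mod L)"
          using xy Q.hom_closed by auto
        show "commutator (G Mod L) (L #> y) (L #> x [^] (p ^ i)) \<in> generate (G Mod L) ?V"
          unfolding V using Suc.IH[OF xy] xy by (simp flip: Q.hom_commutator)
      next
        fix u assume "u \<in> ?V"
        then obtain g where g: "g \<in> carrier G" "u = L #> g [^] (p ^ Suc i)" by auto
        have "u [^]\<^bsub>G Mod L\<^esub> p = L #> g [^] (p ^ Suc (Suc i))"
          using g by (simp add: L.FactGroup_pow nat_pow_pow mult.commute)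
        also have "\<dots> = L"
          using pow_in_power_subgroup[OF g(1), of "p ^ Suc (Suc i)"] L L.rcos_eq_self_iff g by auto
        finally show "u [^]\<^bsub>G Mod L\<^esub> p = \<one>\<^bsub>G Mod L\<^esub>" by simp
      next
        fix u v assume "u \<in> generate (G Mod L) ?V" "v \<in> carrier (G Mod L)"
        then obtain a b where ab: "a \<in> ?P" "u = L #> a" "b \<in> carrier G" "v = L #> b"
          unfolding V by (auto simp: carrier_FactGroup)
        then have "a \<in> carrier G" "commutator G a b \<in> center_mod G L"
          using P unfolding center_mod_def[of G "center_mod G L"] by blast+
        then show "commutator (G Mod L) u v \<in> group_center (G Mod L)"
          using L.mem_center_mod_iff ab by (simp flip: Q.hom_commutator)
      qed
      then show ?thesis
        using xy L.commutator_mem_iff by (simp add: L.FactGroup_pow nat_pow_pow mult.commute)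
    qed
    with L(3) show False by blast
  qed
qed

text \<open>The powerful case applied to \<open>G Mod group_center G\<close> makes the commutator a
  product of a central element and an element of \<open>?M\<close>; both factors are central modulo
  \<open>?M\<close>.\<close>

lemma (in group) quasi_powerful_commutator_pow_central:
  assumes p: "Factorial_Ring.prime p" "odd p" "quasi_powerful p G" and xy: "x \<in> carrier G" "y \<in> carrier G"
  shows "commutator G y (x [^] (p ^ i)) \<in> center_mod G (power_subgroup G (p ^ Suc i))"
proof -
  let ?Z = "group_center G" and ?M = "power_subgroup G (p ^ Suc i)"
  interpret Z: normal ?Z G by (rule normal_center)
  interpret M: normal ?M G by (rule power_subgroup_normal)
  interpret C: normal "center_mod G ?M" G by (rule M.center_mod_normal)
  interpret Q: group_hom G "G Mod ?Z" "(#>) ?Z" by (rule Z.group_hom_Mod)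
  let ?c = "commutator G y (x [^] (p ^ i))"
  have "?Z #> ?c \<in> power_subgroup (G Mod ?Z) (p ^ Suc i)"
    using Q.H.powerful_commutator_pow[of p "?Z #> x" "?Z #> y" i] p xy
    by (simp add: Q.hom_commutator Z.FactGroup_pow quasi_powerful_def powerful_def)
  then obtain m where m: "m \<in> ?M" "?Z #> ?c = ?Z #> m"
    unfolding Z.power_subgroup_Mod by auto
  \<comment> \<open>Equality of cosets is turned back into a factorization in
    \<open>G\<close>.\<close>
  have "?c \<in> ?Z #> m"
    using m(2) xy rcos_self[OF _ subgroup_center, of ?c] by simp
  then obtain z where z: "z \<in> ?Z" "?c = z \<otimes> m" by (auto simp: r_coset_def)
  have "z \<in> center_mod G ?M"
  proof -
    have "commutator G z t = \<one>" if "t \<in> carrier G" for t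
      using that z centerD commutator_eq_one_iff by blast
    then show ?thesis
      unfolding center_mod_def using centerD(1)[OF z(1)] M.one_closed by simp
  qed
  then show ?thesis
    unfolding z(2) using C.m_closed subsetD[OF M.subset_center_mod m(1)] by blast
qed

text \<open>The image of the power subgroup in the quotient by \<open>?M\<close> is abelian as soon
  as its generators commute with each other.\<close>

lemma (in group) quasi_powerful_power_subgroup_commutator:
  assumes p: "Factorial_Ring.prime p" "odd p" "quasi_powerful p G" and i: "i \<ge> 1"
    and uv: "u \<in> power_subgroup G (p ^ i)" "v \<in> power_subgroup G (p ^ i)"
  shows "commutator G u v \<in> power_subgroup G (p ^ Suc i)"
proof -
  let ?M = "power_subgroup G (p ^ Suc i)" and ?U = "{g [^] (p ^ i) | g. g \<in> carrier G}"
  interpret M: normal ?M G by (rule power_subgroup_normal)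
  interpret Q: group_hom G "G Mod ?M" "(#>) ?M" by (rule M.group_hom_Mod)
  let ?V = "(#>) ?M ` ?U"
  have V: "generate (G Mod ?M) ?V = (#>) ?M ` power_subgroup G (p ^ i)"
    unfolding power_subgroup_def[of G "p ^ i"] by (rule Q.generate_img[OF power_set_incl])
  have sub: "?V \<subseteq> carrier (G Mod ?M)" using power_set_incl Q.hom_closed by blast
  have comm: "a \<otimes>\<^bsub>G Mod ?M\<^esub> b = b \<otimes>\<^bsub>G Mod ?M\<^esub> a" if ab: "a \<in> ?V" "b \<in> ?V" for a b
  proof -
    obtain g h where gh: "g \<in> carrier G" "h \<in> carrier G"
      "a = ?M #> g [^] (p ^ i)" "b = ?M #> h [^] (p ^ i)"
      using ab by auto
    \<comment> \<open>A \<open>p\<close>-th root of \<open>b\<close> modulo \<open>?M\<close>; the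
      exponent \<open>i - 1\<close> makes sense as a root because \<open>i \<ge> 1\<close>.\<close>
    let ?y = "?M #> h [^] (p ^ (i - 1))"
    have "p ^ (i - 1) * p = p ^ i"
      using i by (simp add: power_eq_if)
    then have y: "?y \<in> carrier (G Mod ?M)" "?y [^]\<^bsub>G Mod ?M\<^esub> p = b"
      using gh Q.hom_closed[of "h [^] (p ^ (i - 1))"]
      by (simp_all add: M.FactGroup_pow nat_pow_pow del: power_Suc)
    have a: "a \<in> carrier (G Mod ?M)" using ab sub by blast
    have "a [^]\<^bsub>G Mod ?M\<^esub> p = ?M #> g [^] (p ^ Suc i)"
      using gh by (simp add: M.FactGroup_pow nat_pow_pow mult.commute[of _ p] power_Suc[symmetric]
          del: power_Suc)
    also have "\<dots> = \<one>\<^bsub>G Mod ?M\<^esub>"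
      using gh M.rcos_eq_self_iff pow_in_power_subgroup[of g "p ^ Suc i"] by simp
    finally have ap: "a [^]\<^bsub>G Mod ?M\<^esub> p = \<one>\<^bsub>G Mod ?M\<^esub>" .
    \<comment> \<open>With this commutator central and the \<open>p\<close>-th power of
      \<open>a\<close> trivial, \<open>a\<close> commutes with the \<open>p\<close>-th power of
      \<open>?y\<close>, which is \<open>b\<close>.\<close>
    have "commutator (G Mod ?M) ?y a \<in> group_center (G Mod ?M)"
      using quasi_powerful_commutator_pow_central[OF p gh(1), of "h [^] (p ^ (i - 1))" i]
        M.mem_center_mod_iff gh by (simp flip: Q.hom_commutator del: power_Suc)
    then have "commutator (G Mod ?M) a ?y \<in> group_center (G Mod ?M)"
      using Q.H.central_commutator_inv y a by blast
    from Q.H.commutes_pow_of_pow_eq_one[OF a y(1) this ap] show ?thesis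
      using y by simp
  qed
  \<comment> \<open>Commutation is extended from generators to the generated subgroup, one argument
    at a time.\<close>
  have comm': "w \<otimes>\<^bsub>G Mod ?M\<^esub> a = a \<otimes>\<^bsub>G Mod ?M\<^esub> w"
    if a: "a \<in> ?V" and w: "w \<in> generate (G Mod ?M) ?V" for a w
  proof (rule sym, rule Q.H.commutes_generate[OF sub _ _ w])
    show "a \<in> carrier (G Mod ?M)" using a sub by (rule rev_subsetD)
    show "a \<otimes>\<^bsub>G Mod ?M\<^esub> b = b \<otimes>\<^bsub>G Mod ?M\<^esub> a" if "b \<in> ?V" for b
      using a that by (rule comm)
  qed
  have comm'': "w \<otimes>\<^bsub>G Mod ?M\<^esub> w' = w' \<otimes>\<^bsub>G Mod ?M\<^esub> w"
    if w: "w \<in> generate (G Mod ?M) ?V" and w': "w' \<in> generate (G Mod ?M) ?V" for w w'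
  proof (rule Q.H.commutes_generate[OF sub _ _ w'])
    show "w \<in> carrier (G Mod ?M)" using sub w by (rule Q.H.generate_in_carrier)
    show "w \<otimes>\<^bsub>G Mod ?M\<^esub> a = a \<otimes>\<^bsub>G Mod ?M\<^esub> w" if "a \<in> ?V" for a
      using that w by (rule comm')
  qed
  interpret N: normal "power_subgroup G (p ^ i)" G by (rule power_subgroup_normal)
  show ?thesis
    unfolding M.commutator_mem_iff[OF N.mem_carrier[OF uv(1)] N.mem_carrier[OF uv(2)]]
    by (rule comm'') (use uv in \<open>simp_all only: V imageI\<close>)
qed

section \<open>The power subgroup as a group of its own\<close>

theorem theorem2:
  fixes G :: "('a, 'b) monoid_scheme" and p :: nat
  assumes "Factorial_Ring.prime p" and "odd p"
    and "quasi_powerful p G"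
  shows "\<forall>i \<ge> 1. powerful p (G\<lparr>carrier := power_subgroup G (p ^ i)\<rparr>)"
proof (intro allI impI)
  fix i :: nat assume i: "i \<ge> 1"
  have pG: "p_group p G" using assms by (simp add: quasi_powerful_def)
  interpret group G using pG by (simp add: p_group_def)
  let ?P = "power_subgroup G (p ^ i)"
  have P: "subgroup ?P G" by (rule normal_imp_subgroup[OF power_subgroup_normal])
  interpret P: subgroup ?P G by (rule P)
  let ?H = "G\<lparr>carrier := ?P\<rparr>"
  have grp: "group ?H" by (rule subgroup_imp_group[OF P])
  interpret H: group ?H by (rule grp)
  have fin: "finite ?P"
    using pG P.subset finite_subset by (auto simp: p_group_def)
  have "p_group p ?H"
  proof -
    obtain n where n: "order G = p ^ n" using pG by (auto simp: p_group_def)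
    have "card ?P dvd p ^ n" using lagrange[OF P] n by (metis dvd_triv_right)
    then have "\<exists>k. card ?P = p ^ k" using assms(1) divides_primepow_nat by metis
    then show ?thesis using grp fin by (simp add: p_group_def order_def)
  qed
  moreover have "derived ?H (carrier ?H) \<subseteq> power_subgroup ?H p"
  proof -
    \<comment> \<open>Powers and generation in \<open>?H\<close> are rewritten as those in
      \<open>G\<close>, so that both sides can be compared inside \<open>G\<close>.\<close>
    have pow: "power_subgroup ?H p = generate G {g [^]\<^bsub>G\<^esub> p | g. g \<in> ?P}"
    proof -
      have "{g [^]\<^bsub>?H\<^esub> p | g. g \<in> ?P} = {g [^]\<^bsub>G\<^esub> p | g. g \<in> ?P}"
        by (simp add: nat_pow_consistent[symmetric])
      moreover have "{g [^]\<^bsub>G\<^esub> p | g. g \<in> ?P} \<subseteq> ?P"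
        using H.nat_pow_closed[of _ p] by (auto simp: nat_pow_consistent[symmetric])
      ultimately show ?thesis
        unfolding power_subgroup_def[of ?H] using generate_consistent[OF _ P] by simp
    qed
    \<comment> \<open>A \<open>p ^ Suc i\<close>-th power is the \<open>p\<close>-th power of an
      element of \<open>?P\<close>; this bounds the target of the commutator lemma by the
      \<open>p\<close>-th power subgroup of \<open>?H\<close>.\<close>
    have "{g [^]\<^bsub>G\<^esub> (p ^ Suc i) | g. g \<in> carrier G} \<subseteq> {g [^]\<^bsub>G\<^esub> p | g. g \<in> ?P}"
    proof
      fix u assume "u \<in> {g [^]\<^bsub>G\<^esub> (p ^ Suc i) | g. g \<in> carrier G}"
      then obtain g where g: "g \<in> carrier G" "u = g [^]\<^bsub>G\<^esub> (p ^ Suc i)" by auto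
      then have "u = (g [^]\<^bsub>G\<^esub> (p ^ i)) [^]\<^bsub>G\<^esub> p" by (simp add: nat_pow_pow mult.commute)
      then show "u \<in> {g [^]\<^bsub>G\<^esub> p | g. g \<in> ?P}" using pow_in_power_subgroup g by blast
    qed
    then have le: "power_subgroup G (p ^ Suc i) \<subseteq> power_subgroup ?H p"
      unfolding pow power_subgroup_def[of G "p ^ Suc i"] by (rule mono_generate)
    have "derived_set G ?P \<subseteq> power_subgroup G (p ^ Suc i)"
      using quasi_powerful_power_subgroup_commutator[OF assms i] by (auto simp: commutator_def)
    then have "derived G ?P \<subseteq> power_subgroup G (p ^ Suc i)"
      unfolding derived_def
      using generate_subgroup_incl normal_imp_subgroup[OF power_subgroup_normal] by blast
    then show ?thesis using le derived_consistent[OF _ P, of ?P] by simp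
  qed
  ultimately show "powerful p ?H" by (simp add: powerful_def)
qed

end
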